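(* Let $n\geq3$ and let $\mathcal{E}\subset\mathbb{C}^{n\times n}$ be the set of complex matrices all of whose eigenvalues lie in the closed left half-plane $\{z\in\mathbb{C}:\Re z\le0\}$. If $A\in\mathbb{R}^{n\times n}$ is sampled uniformly from the unit sphere $\{A\in\mathbb{R}^{n\times n}:\|A\|_F=1\}$, then $$0<\mathbb{P}\bigl(d_{\mathbb{R}}(A)=d_{\mathbb{C}}(A)\mid A\notin\mathcal{E}\bigr)<1.$$
   Context: $\|\cdot\|_F$ is the Frobenius norm. For $A\in\mathbb{R}^{n\times n}$, $d_{\mathbb{C}}(A)=\min_{X\in\mathcal{E}}\|A-X\|_F$ and $d_{\mathbb{R}}(A)=\min_{X\in\mathcal{E}\cap\mathbb{R}^{n\times n}}\|A-X\|_F$. The event $d_{\mathbb{R}}(A)=d_{\mathbb{C}}(A)$ is the event that $A$ has a real nearest matrix in $\mathcal{E}$. *)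

theory Defs
  imports "HOL-Probability.Probability"
begin

definition eigenvalue :: "complex ^ 'n ^ 'n \<Rightarrow> complex \<Rightarrow> bool" where
  "eigenvalue X z \<longleftrightarrow> (\<exists>v. v \<noteq> 0 \<and> X *v v = z *s v)"

definition stable_matrices :: "(complex ^ 'n ^ 'n) set" where
  "stable_matrices = {X. \<forall>z. eigenvalue X z \<longrightarrow> Re z \<le> 0}"

definition real_matrices :: "(complex ^ 'n ^ 'n) set" where
  "real_matrices = {X. \<forall>i j. X $ i $ j \<in> \<real>}"

abbreviation complexify :: "real ^ 'n ^ 'n \<Rightarrow> complex ^ 'n ^ 'n" where
  "complexify \<equiv> map_matrix complex_of_real"

(* The library norm on the iterated vector type is the Frobenius norm. *)
lemma norm_eq_frobenius:
  fixes A :: "'a::real_normed_vector ^ 'n ^ 'm"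
  shows "norm A = sqrt (\<Sum>i\<in>UNIV. \<Sum>j\<in>UNIV. (norm (A $ i $ j))\<^sup>2)"
  by (simp add: norm_vec_def L2_set_def sum_nonneg)

(* A genuine minimum: the value is unspecified if no point of S is nearest to A. *)
definition min_dist :: "'a::real_normed_vector \<Rightarrow> 'a set \<Rightarrow> real" where
  "min_dist A S = (LEAST d. \<exists>X\<in>S. d = norm (A - X))"

lemma min_dist_eqI:
  assumes "X \<in> S" "\<And>Y. Y \<in> S \<Longrightarrow> norm (A - X) \<le> norm (A - Y)"
  shows "min_dist A S = norm (A - X)"
  unfolding min_dist_def using assms by (intro Least_equality) auto

lemma min_dist_closed:
  fixes A :: "'a::euclidean_space"
  assumes "closed S" "S \<noteq> {}"
  shows "min_dist A S = infdist A S"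
proof -
  obtain X where X: "X \<in> S" "infdist A S = dist A X"
    using infdist_attains_inf assms by blast
  have "min_dist A S = norm (A - X)"
    using X by (intro min_dist_eqI) (metis dist_norm infdist_le)+
  with X show ?thesis
    by (simp add: dist_norm)
qed

definition d_complex :: "real ^ 'n ^ 'n \<Rightarrow> real" where
  "d_complex A = min_dist (complexify A) stable_matrices"

definition d_real :: "real ^ 'n ^ 'n \<Rightarrow> real" where
  "d_real A = min_dist (complexify A) (stable_matrices \<inter> real_matrices)"

(* The rotation-invariant probability on the unit sphere, as a Borel measure on the ambient
   space: the law of x / norm x for x uniform in the unit ball (sgn is that radial projection). *)
definition uniform_sphere :: "'a::euclidean_space measure" where
  "uniform_sphere = distr (uniform_measure lborel (ball 0 1)) borel sgn"

lemma sgn_borel_measurable [measurable]: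
  "(sgn :: 'a::euclidean_space \<Rightarrow> 'a) \<in> borel_measurable borel"
proof -
  have "(\<lambda>x::'a. x /\<^sub>R norm x) \<in> borel_measurable borel"
    by measurable
  then show ?thesis
    by (simp add: sgn_div_norm[abs_def])
qed

lemma prob_space_uniform_sphere: "prob_space (uniform_sphere :: 'a::euclidean_space measure)"
  unfolding uniform_sphere_def
proof (intro prob_space.prob_space_distr prob_space_uniform_measure)
  show "emeasure lborel (ball (0::'a) 1) \<noteq> 0"
    using open_not_negligible[of "ball (0::'a) 1"]
    by (auto simp: negligible_iff_null_sets null_sets_def)
  show "emeasure lborel (ball (0::'a) 1) \<noteq> \<infinity>"
    using emeasure_bounded_finite[of "ball (0::'a) 1"] by auto
qed simp

lemma AE_uniform_sphere: "AE x in (uniform_sphere :: 'a::euclidean_space measure). x \<in> sphere 0 1"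
proof -
  have "AE x in lborel. x \<noteq> (0::'a)"
    by (rule AE_lborel_singleton)
  then have "AE x in uniform_measure lborel (ball (0::'a) 1). sgn x \<in> sphere 0 1"
    by (intro AE_uniform_measureI) (auto simp: norm_sgn)
  then show ?thesis
    unfolding uniform_sphere_def by (subst AE_distr_iff) (auto simp: sphere_def)
qed

end

theory Submission
  imports Defs "HOL-Complex_Analysis.Great_Picard"
begin

text \<open>
  Both distances are continuous and positively homogeneous, so it suffices to find a nonempty open
  set of unstable real matrices on which they agree, and a single real matrix at which they differ.

  They agree near the matrix \<open>diag(0, -1, \<dots>, -1)\<close>: there a stable matrix is one whose simple
  eigenvalue near \<open>0\<close> has nonpositive real part, and a stable complex \<open>M + i N\<close> can be replaced by a
  stable real matrix at distance \<open>O(\<parallel>N\<parallel>\<^sup>2)\<close> from \<open>M\<close>, which is no farther from a nearby real matrix.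

  They differ at the direct sum \<open>A\<close> of a cyclic permutation matrix of order 3 and of \<open>-I\<close>. Real
  stable \<open>Y\<close> satisfy \<open>det (-Y) \<ge> 0\<close>, whereas \<open>det (-A) = -1\<close>, and \<open>A\<close> is orthogonal; so \<open>A\<close> has distance
  at least 1 from them. But there is a complex stable matrix at squared distance \<open>7/8\<close>.
\<close>

subsection \<open>Stable matrices and the two distances\<close>

text \<open>Cauchy-Schwarz in each row, then summation over the rows; this lets the Frobenius norm
  stand in for the operator norm.\<close>

lemma norm_matrix_vector_mult_le:
  fixes A :: "'a::real_normed_field ^ 'n ^ 'm"
  shows "norm (A *v x) \<le> norm A * norm x"
proof -
  have "norm ((A *v x) $ i) \<le> norm x * norm (A $ i)" for i
  proof -
    have "norm ((A *v x) $ i) \<le> (\<Sum>j\<in>UNIV. \<bar>norm (A $ i $ j)\<bar> * \<bar>norm (x $ j)\<bar>)"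
      unfolding matrix_vector_mult_def by (auto simp: norm_mult intro!: sum_norm_le)
    also have "\<dots> \<le> norm (A $ i) * norm x"
      unfolding norm_vec_def by (rule L2_set_mult_ineq)
    finally show ?thesis by (simp add: mult.commute)
  qed
  then have "norm (A *v x) \<le> L2_set (\<lambda>i. norm x * norm (A $ i)) UNIV"
    unfolding norm_vec_def[of "A *v x"] by (intro L2_set_mono) auto
  also have "\<dots> = norm A * norm x"
    by (simp add: norm_vec_def[of A] L2_set_right_distrib mult.commute)
  finally show ?thesis .
qed

lemma norm_vector_scalar_mult:
  fixes x :: "'a::real_normed_field ^ 'n"
  shows "norm (c *s x) = norm c * norm x"
  by (simp add: norm_vec_def norm_mult L2_set_right_distrib)

lemma det_eq_0_iff_kernel:
  fixes A :: "'a::field ^ 'n ^ 'n"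
  shows "det A = 0 \<longleftrightarrow> (\<exists>v. v \<noteq> 0 \<and> A *v v = 0)"
  using invertible_det_nz[of A] matrix_left_invertible_ker[of A] invertible_left_inverse[of A]
  by auto

lemma continuous_on_det [continuous_intros]:
  fixes f :: "'b::topological_space \<Rightarrow> 'a::real_normed_field ^ 'n ^ 'n"
  assumes "\<And>i j. continuous_on S (\<lambda>x. f x $ i $ j)"
  shows "continuous_on S (\<lambda>x. det (f x))"
  unfolding det_def by (intro continuous_intros assms)

lemma mat_mult_vec: "mat c *v x = c *s x"
  for x :: "'a::comm_semiring_1 ^ 'n"
  by (simp add: mat_def matrix_vector_mult_def vec_eq_iff if_distrib[where f = "\<lambda>a. a * _"]
      cong: if_cong)

lemma eigenvalue_iff_det: "eigenvalue X z \<longleftrightarrow> det (mat z - X) = 0"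
  unfolding eigenvalue_def det_eq_0_iff_kernel
  by (simp add: matrix_vector_mult_diff_rdistrib mat_mult_vec) metis

lemma norm_eigenvalue_le:
  assumes "eigenvalue X z"
  shows "norm z \<le> norm X"
proof -
  obtain v where v: "v \<noteq> 0" "X *v v = z *s v"
    using assms by (auto simp: eigenvalue_def)
  have "norm z * norm v \<le> norm X * norm v"
    using norm_matrix_vector_mult_le[of X v] by (simp add: v(2) norm_vector_scalar_mult)
  then show ?thesis using v(1) by simp
qed

lemma eigenvalue_scaleR:
  assumes "c \<noteq> 0"
  shows "eigenvalue (c *\<^sub>R X) z \<longleftrightarrow> eigenvalue X (z / of_real c)"
proof -
  have "(c *\<^sub>R X) *v v = z *s v \<longleftrightarrow> X *v v = (z / of_real c) *s v" for v
  proof -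
    have "(c *\<^sub>R X) *v v = of_real c *s (X *v v)"
      by (simp add: vec_eq_iff matrix_vector_mult_def sum_distrib_left mult.assoc
          scaleR_conv_of_real[where 'a = complex])
    then show ?thesis
      using assms by (auto simp: vec_eq_iff field_simps)
  qed
  then show ?thesis by (simp add: eigenvalue_def)
qed

lemma stable_matrices_scaleR:
  assumes "c > 0" "X \<in> stable_matrices"
  shows "c *\<^sub>R X \<in> stable_matrices"
  using assms
  by (auto simp: stable_matrices_def eigenvalue_scaleR)
    (metis Re_divide_of_real divide_le_0_iff not_less)

lemma zero_stable: "0 \<in> stable_matrices"
proof -
  have "z = 0" if "eigenvalue 0 z" for z :: complex
    using norm_eigenvalue_le[OF that] by simp
  then show ?thesis by (force simp: stable_matrices_def)
qed

text \<open>Hurwitz's theorem on the right half-plane: a limit of zero-free characteristic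
  functions is zero-free, since it is not constant.\<close>
lemma closed_stable_matrices: "closed (stable_matrices :: (complex ^ 'n ^ 'n) set)"
  unfolding closed_sequential_limits
proof (intro allI impI, elim conjE)
  fix F :: "nat \<Rightarrow> complex ^ 'n ^ 'n" and X
  assume F: "\<forall>n. F n \<in> stable_matrices" and lim: "F \<longlonglongrightarrow> X"
  define H where "H = {z. Re z > 0}"
  define p :: "complex ^ 'n ^ 'n \<Rightarrow> complex \<Rightarrow> complex" where "p M z = det (mat z - M)" for M z
  have p_eq: "p M z = (\<Sum>s | s permutes UNIV. of_int (sign s) *
      (\<Prod>i\<in>UNIV. (if i = s i then z else 0) - M $ i $ s i))" for M z
    by (simp add: p_def det_def mat_def)
  have hol: "p M holomorphic_on H" for M
  proof -
    have "(\<lambda>z. if i = j then z else 0) holomorphic_on H" for i j :: 'n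
      by (cases "i = j") (auto intro!: holomorphic_intros)
    then show ?thesis
      unfolding p_eq by (intro holomorphic_intros)
  qed
  have cont: "continuous_on UNIV (\<lambda>(M, z). p M z)"
  proof -
    have "continuous_on UNIV (\<lambda>x :: (complex ^ 'n ^ 'n) \<times> complex. (mat (snd x) - fst x) $ i $ j)"
      for i j :: 'n
      by (cases "i = j")
        (auto simp: mat_def intro!: continuous_on_diff continuous_on_snd continuous_on_minus
          continuous_on_component continuous_on_fst)
    then show ?thesis
      unfolding p_def case_prod_unfold by (rule continuous_on_det)
  qed
  have unif: "uniform_limit K (\<lambda>n. p (F n)) (p X) sequentially" if "compact K" for K
  proof -
    have "bounded (range F)"
      using lim by (simp add: convergent_imp_bounded)
    then obtain R where R: "\<And>n. norm (F n) \<le> R"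
      by (auto simp: bounded_iff)
    have XR: "norm X \<le> R"
      using tendsto_norm[OF lim] R by (intro LIMSEQ_le_const2) auto
    \<comment> \<open>The sequence and its limit stay in one compact ball, on which joint continuity
      is uniform; so convergence of \<open>F n\<close> to \<open>X\<close> carries over uniformly in
      \<open>z \<in> K\<close>.\<close>
    have "uniformly_continuous_on (cball 0 R \<times> K) (\<lambda>(M, z). p M z)"
      by (intro compact_uniformly_continuous compact_Times compact_cball that
          continuous_on_subset[OF cont]) auto
    then have uc: "\<exists>d>0. \<forall>x\<in>cball 0 R \<times> K. \<forall>y\<in>cball 0 R \<times> K. dist y x < d \<longrightarrow>
        dist ((\<lambda>(M, z). p M z) y) ((\<lambda>(M, z). p M z) x) < e" if "e > 0" for e
      using that unfolding uniformly_continuous_on_def by blast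
    show ?thesis
    proof (rule uniform_limitI)
      fix e :: real assume "e > 0"
      from uc[OF this] obtain d where d: "d > 0"
        "\<And>x y. x \<in> cball 0 R \<times> K \<Longrightarrow> y \<in> cball 0 R \<times> K \<Longrightarrow> dist y x < d \<Longrightarrow>
           dist ((\<lambda>(M, z). p M z) y) ((\<lambda>(M, z). p M z) x) < e" by blast
      have "\<forall>\<^sub>F n in sequentially. dist (F n) X < d"
        using lim d(1) by (rule tendstoD)
      then show "\<forall>\<^sub>F n in sequentially. \<forall>z\<in>K. dist (p (F n) z) (p X z) < e"
      proof eventually_elim
        case (elim n)
        show ?case
        proof
          fix z assume "z \<in> K"
          then show "dist (p (F n) z) (p X z) < e"
            using d(2)[of "(X, z)" "(F n, z)"] elim XR R by (simp add: dist_Pair_Pair)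
        qed
      qed
    qed
  qed
  have "\<not> eigenvalue X z0" if z0: "z0 \<in> H" for z0
  proof
    assume "eigenvalue X z0"
    then have p0: "p X z0 = 0"
      by (simp add: eigenvalue_iff_det p_def)
    have "p X z0 \<noteq> 0"
    proof (rule Hurwitz_no_zeros[of H "\<lambda>n. p (F n)" "p X" z0])
      show "open H" unfolding H_def by (rule open_halfspace_Re_gt)
      show "connected H" unfolding H_def by (intro convex_connected convex_halfspace_Re_gt)
      show "\<not> p X constant_on H"
      proof
        assume "p X constant_on H"
        \<comment> \<open>Eigenvalues have modulus at most \<open>norm X\<close>, so
          \<open>w\<close> is not a zero, whereas a constant \<open>p X\<close> would vanish at
          \<open>w\<close> as it does at \<open>z0\<close>.\<close>
        moreover define w :: complex where "w = of_real (norm X + 1)"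
        have "w \<in> H"
          unfolding w_def H_def using norm_ge_zero[of X] by (simp del: norm_ge_zero)
        ultimately have "p X w = 0"
          using p0 z0 by (metis constant_on_def)
        then have "norm w \<le> norm X"
          using norm_eigenvalue_le[of X w] by (simp add: eigenvalue_iff_det p_def)
        then show False
          by (simp add: w_def del: of_real_add)
      qed
      show "p (F n) z \<noteq> 0" if "z \<in> H" for n z
        using F that by (force simp: stable_matrices_def H_def eigenvalue_iff_det p_def)
    qed (use hol unif z0 in auto)
    with p0 show False by simp
  qed
  then show "X \<in> stable_matrices"
    by (force simp: stable_matrices_def H_def)
qed

lemma closed_real_matrices: "closed (real_matrices :: (complex ^ 'n ^ 'n) set)"
proof -
  have eq: "real_matrices = (\<Inter>i j. (\<lambda>X::complex^'n^'n. X $ i $ j) -` \<real>)"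
    by (auto simp: real_matrices_def)
  show ?thesis
    unfolding eq
    by (intro closed_INT ballI closed_vimage closed_complex_Reals continuous_intros)
qed

section \<open>Real matrices among the complex ones\<close>

lemma complexify_real: "complexify A \<in> real_matrices"
  by (simp add: real_matrices_def)

lemma real_matricesE:
  assumes "X \<in> real_matrices"
  obtains A where "X = complexify A"
proof
  show "X = complexify (map_matrix Re X)"
    using assms by (auto simp: real_matrices_def vec_eq_iff map_matrix_def)
qed

lemma norm_complexify: "norm (complexify A) = norm A"
  by (simp add: norm_eq_frobenius)

lemma complexify_diff: "complexify A - complexify B = complexify (A - B)"
  by (simp add: vec_eq_iff)

lemma complexify_scaleR: "complexify (c *\<^sub>R A) = c *\<^sub>R complexify A"
  by (simp add: vec_eq_iff scaleR_conv_of_real[where 'a = complex])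

lemma continuous_on_complexify [continuous_intros]: "continuous_on S complexify"
  unfolding map_matrix_def
  by (intro continuous_intros continuous_on_vec_lambda)

section \<open>Continuity and homogeneity of the two distances\<close>

lemma d_complex_infdist: "d_complex A = infdist (complexify A) stable_matrices"
  unfolding d_complex_def using zero_stable
  by (intro min_dist_closed closed_stable_matrices) auto

lemma zero_stable_real: "0 \<in> stable_matrices \<inter> real_matrices"
  using zero_stable by (simp add: real_matrices_def)

lemma d_real_infdist: "d_real A = infdist (complexify A) (stable_matrices \<inter> real_matrices)"
  unfolding d_real_def using zero_stable_real
  by (intro min_dist_closed closed_Int closed_stable_matrices closed_real_matrices) auto

lemma continuous_on_d_complex [continuous_intros]: "continuous_on S d_complex"
  unfolding d_complex_infdist by (intro continuous_intros)

lemma continuous_on_d_real [continuous_intros]: "continuous_on S d_real"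
  unfolding d_real_infdist by (intro continuous_intros)

lemma d_complex_le_d_real: "d_complex A \<le> d_real A"
  unfolding d_complex_infdist d_real_infdist
  using zero_stable_real by (intro infdist_mono) auto

text \<open>Scaling competitors inside the cone gives \<open>\<le>\<close> for every positive
  factor; the reverse is the same inequality for \<open>inverse c\<close> at the scaled point. For
  empty \<open>S\<close> both sides are 0 by the convention for \<open>infdist\<close>.\<close>

lemma infdist_scaleR_cone:
  fixes S :: "'a::real_normed_vector set"
  assumes cone: "\<And>c X. c > 0 \<Longrightarrow> X \<in> S \<Longrightarrow> c *\<^sub>R X \<in> S" and "c > 0"
  shows "infdist (c *\<^sub>R A) S = c * infdist A S"
proof (cases "S = {}")
  case False
  have le: "infdist (c *\<^sub>R A) S \<le> c * infdist A S" if "c > 0" for c A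
  proof -
    have "infdist (c *\<^sub>R A) S / c \<le> dist A X" if "X \<in> S" for X
    proof -
      have "infdist (c *\<^sub>R A) S \<le> dist (c *\<^sub>R A) (c *\<^sub>R X)"
        using that \<open>c > 0\<close> by (intro infdist_le cone)
      also have "\<dots> = c * dist A X"
        using \<open>c > 0\<close> by (simp add: dist_norm flip: scaleR_diff_right)
      finally show ?thesis using \<open>c > 0\<close> by (simp add: field_simps)
    qed
    then have "infdist (c *\<^sub>R A) S / c \<le> infdist A S"
      using False by (auto simp: infdist_def[of A] intro!: cINF_greatest)
    then show ?thesis using \<open>c > 0\<close> by (simp add: field_simps)
  qed
  have "infdist A S \<le> inverse c * infdist (c *\<^sub>R A) S"
    using le[of "inverse c" "c *\<^sub>R A"] \<open>c > 0\<close> by simp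
  then show ?thesis
    using le[OF \<open>c > 0\<close>, of A] \<open>c > 0\<close> by (simp add: field_simps)
qed (simp add: infdist_def)

lemma real_matrices_scaleR: "X \<in> real_matrices \<Longrightarrow> c *\<^sub>R X \<in> real_matrices"
  by (auto simp: real_matrices_def scaleR_conv_of_real[where 'a = complex])

lemma d_complex_scaleR: "c > 0 \<Longrightarrow> d_complex (c *\<^sub>R A) = c * d_complex A"
  unfolding d_complex_infdist complexify_scaleR
  by (intro infdist_scaleR_cone stable_matrices_scaleR)

lemma d_real_scaleR: "c > 0 \<Longrightarrow> d_real (c *\<^sub>R A) = c * d_real A"
  unfolding d_real_infdist complexify_scaleR
  by (intro infdist_scaleR_cone) (auto intro: stable_matrices_scaleR real_matrices_scaleR)

lemma stable_matrices_scaleR_iff: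
  assumes "c > 0"
  shows "c *\<^sub>R X \<in> stable_matrices \<longleftrightarrow> X \<in> stable_matrices"
  using stable_matrices_scaleR[OF assms] stable_matrices_scaleR[of "inverse c" "c *\<^sub>R X"] assms
  by auto

lemma d_eq_0_if_stable:
  assumes "complexify A \<in> stable_matrices"
  shows "d_real A = 0" "d_complex A = 0"
  using assms complexify_real[of A] unfolding d_complex_infdist d_real_infdist
  by (auto intro!: infdist_zero)

subsection \<open>Equality near a simple eigenvalue\<close>

text \<open>The matrix \<open>diag(-1, ..., 0, ..., -1)\<close> with its 0 at position
  \<open>k\<close>, polymorphic so that one definition serves real and complex matrices.\<close>

definition spike :: "'n \<Rightarrow> 'a::comm_ring_1 ^ 'n ^ 'n" where
  "spike k = (\<chi> i j. if i = j then (if i = k then 0 else - 1) else 0)"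

lemma spike_mult_vec: "spike k *v v = - v + v $ k *s axis k 1"
  for v :: "'a::comm_ring_1 ^ 'n"
  by (simp add: spike_def vec_eq_iff matrix_vector_mult_def axis_def
      if_distrib[where f = "\<lambda>a. a * _"] cong: if_cong)

lemma complexify_spike: "complexify (spike k) = spike k"
  by (auto simp: spike_def vec_eq_iff)

lemma norm_axis: "norm (axis k x) = norm x"
  for x :: "'a::real_normed_vector"
  by (simp add: norm_vec_def L2_set_def axis_def if_distrib[where f = norm]
      if_distrib[where f = "\<lambda>a. a\<^sup>2"] cong: if_cong)

text \<open>On vectors with vanishing entry \<open>k\<close>, \<open>X\<close> is close to minus the
  identity. So an eigenvector for an eigenvalue in the open right half-plane must be a multiple of
  \<open>a\<close>, which makes that eigenvalue \<alpha>.\<close>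

lemma stable_near_spike:
  fixes X :: "complex ^ 'n ^ 'n"
  assumes near: "norm (X - spike k) \<le> 1 / 16"
    and a: "X *v a = \<alpha> *s a" "a $ k = 1" "norm a \<le> 3 / 2" and "Re \<alpha> \<le> 0"
  shows "X \<in> stable_matrices"
proof -
  define B where "B = X - spike k"
  have "Re \<mu> \<le> 0" if ev: "eigenvalue X \<mu>" for \<mu>
  proof (rule ccontr)
    assume \<mu>: "\<not> Re \<mu> \<le> 0"
    obtain v where v: "v \<noteq> 0" "X *v v = \<mu> *s v"
      using ev by (auto simp: eigenvalue_def)
    \<comment> \<open>Subtracting this multiple of \<open>a\<close> cancels entry \<open>k\<close>,
      so \<open>spike k\<close> acts on \<open>y\<close> as -1.\<close>
    define y where "y = v - v $ k *s a"
    have yk: "y $ k = 0" by (simp add: y_def a)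
    have Xy: "X *v y = \<mu> *s y + (v $ k * (\<mu> - \<alpha>)) *s a"
      by (simp add: y_def matrix_vector_mult_diff_distrib vector_scalar_commute v a
          vec_eq_iff algebra_simps)
    have XB: "X *v y = - y + B *v y"
      by (simp add: B_def matrix_vector_mult_diff_rdistrib spike_mult_vec yk)
    \<comment> \<open>Comparing entry \<open>k\<close> of the two expressions for
      \<open>X *v y\<close> shows that the coefficient of \<open>a\<close> is an entry of
      \<open>B *v y\<close>, hence small.\<close>
    have c: "(B *v y) $ k = v $ k * (\<mu> - \<alpha>)"
      using arg_cong[OF trans[OF XB[symmetric] Xy], of "\<lambda>u. u $ k"] by (simp add: yk a)
    have "- y + B *v y = \<mu> *s y + (B *v y) $ k *s a"
      using Xy unfolding XB c .
    then have "B *v y - (B *v y) $ k *s a = y + \<mu> *s y"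
      by (simp add: algebra_simps)
    then have "(1 + \<mu>) *s y = B *v y - (B *v y) $ k *s a"
      by (simp add: vec_eq_iff distrib_right)
    then have "norm (1 + \<mu>) * norm y \<le> norm (B *v y) + norm ((B *v y) $ k) * norm a"
      by (metis norm_triangle_ineq4 norm_vector_scalar_mult)
    \<comment> \<open>The total factor is 1/16 + 3/32 = 5/32, while \<open>norm (1 + \<mu>)\<close>
      is at least 1; this forces \<open>y = 0\<close>.\<close>
    also have "\<dots> \<le> 1 / 16 * norm y + (1 / 16 * norm y) * (3 / 2)"
    proof -
      have "norm (B *v y) \<le> 1 / 16 * norm y"
        using norm_matrix_vector_mult_le[of B y] near unfolding B_def[symmetric]
        by (meson mult_right_mono norm_ge_zero order_trans)
      moreover from this have "norm ((B *v y) $ k) \<le> 1 / 16 * norm y"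
        using Finite_Cartesian_Product.norm_nth_le order_trans by blast
      ultimately show ?thesis using a(3) by (intro add_mono mult_mono) auto
    qed
    finally have "norm (1 + \<mu>) * norm y \<le> 5 / 32 * norm y" by simp
    moreover have "1 \<le> norm (1 + \<mu>)"
      using \<mu> complex_Re_le_cmod[of "1 + \<mu>"] by simp
    then have "1 * norm y \<le> norm (1 + \<mu>) * norm y"
      by (rule mult_right_mono) simp
    ultimately have "norm y \<le> 5 / 32 * norm y" by linarith
    then have "norm y \<le> 0" by simp
    then have "y = 0" by simp
    then have va: "v = v $ k *s a" by (simp add: y_def)
    then have "v $ k \<noteq> 0" using v(1) by auto
    moreover have "v $ k * (\<mu> - \<alpha>) = 0"
      using Xy a(2) \<open>y = 0\<close> by (auto simp: vec_eq_iff dest!: spec[of _ k])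
    ultimately have "\<mu> = \<alpha>" by simp
    with \<mu> \<open>Re \<alpha> \<le> 0\<close> show False by simp
  qed
  then show ?thesis by (auto simp: stable_matrices_def)
qed

lemma spike_stable: "(spike k :: complex ^ 'n ^ 'n) \<in> stable_matrices"
proof (rule stable_near_spike[of _ k "axis k 1" 0])
  show "norm (axis k (1::complex) :: complex ^ 'n) \<le> 3 / 2"
    by (simp add: norm_axis)
  show "spike k *v axis k 1 = (0::complex) *s axis k 1"
    by (simp only: spike_mult_vec) (simp add: axis_def vec_eq_iff)
qed (simp_all add: axis_def)

text \<open>The eigenvector is a fixed point of \<open>v \<mapsto> e + B v - (B v)\<^sub>k v\<close>, where \<open>B\<close> is the
  perturbation and \<open>e\<close> the unit vector.\<close>
lemma eigenvector_near_spike: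
  fixes X :: "complex ^ 'n ^ 'n"
  assumes near: "norm (X - spike k) \<le> 1 / 30"
  obtains v where "X *v v = ((X - spike k) *v v) $ k *s v" "v $ k = 1" "norm v \<le> 3 / 2"
proof -
  define B where "B = X - spike k"
  define e :: "complex ^ 'n" where "e = axis k 1"
  have norm_e: "norm e = 1" and ek: "e $ k = 1" by (simp_all add: e_def norm_axis)
  define f where "f v = e + B *v v - (B *v v) $ k *s v" for v
  have Bv: "norm (B *v v) \<le> 1 / 20" if "norm v \<le> 3 / 2" for v
  proof -
    have "norm (B *v v) \<le> 1 / 30 * (3 / 2)"
      using norm_matrix_vector_mult_le[of B v] near that unfolding B_def[symmetric]
      by (smt (verit) mult_mono norm_ge_zero)
    then show ?thesis by simp
  qed
  have Bvk: "norm ((B *v v) $ k) \<le> 1 / 20" if "norm v \<le> 3 / 2" for v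
    using Bv[OF that] Finite_Cartesian_Product.norm_nth_le order_trans by blast
  have small: "norm v \<le> 3 / 2" if "v \<in> cball e (1 / 2)" for v
    using that norm_e norm_triangle_ineq2[of v e] by (simp add: dist_norm norm_minus_commute)
  have "continuous_on (cball e (1 / 2)) f"
    unfolding f_def matrix_vector_mult_def vector_scalar_mult_def
    by (intro continuous_intros continuous_on_vec_lambda)
  moreover have "f \<in> cball e (1 / 2) \<rightarrow> cball e (1 / 2)"
  proof
    fix v assume "v \<in> cball e (1 / 2)"
    then have v: "norm v \<le> 3 / 2" by (rule small)
    have "norm (f v - e) \<le> norm (B *v v) + norm ((B *v v) $ k) * norm v"
      unfolding f_def using norm_triangle_ineq4[of "B *v v" "(B *v v) $ k *s v"]
      by (simp add: norm_vector_scalar_mult)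
    also have "\<dots> \<le> 1 / 20 + 1 / 20 * (3 / 2)"
      using Bv[OF v] Bvk[OF v] v by (intro add_mono mult_mono) auto
    finally show "f v \<in> cball e (1 / 2)" by (simp add: dist_norm norm_minus_commute)
  qed
  ultimately obtain v where v: "v \<in> cball e (1 / 2)" "f v = v"
    using brouwer_ball[of "1 / 2" e f] by auto
  \<comment> \<open>Entry \<open>k\<close> of the fixed-point equation factors in this way; the
    second factor is nonzero because \<open>B *v v\<close> is small, which leaves
    \<open>v $ k = 1\<close>.\<close>
  have "(1 - v $ k) * (1 + (B *v v) $ k) = 0"
  proof -
    have "1 + (B *v v) $ k - (B *v v) $ k * v $ k = v $ k"
      using arg_cong[OF v(2), of "\<lambda>u. u $ k"] by (simp add: f_def ek)
    moreover have "(1 - v $ k) * (1 + (B *v v) $ k) = 1 + (B *v v) $ k - (B *v v) $ k * v $ k - v $ k"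
      by (simp add: algebra_simps)
    ultimately show ?thesis by simp
  qed
  moreover have "1 + (B *v v) $ k \<noteq> 0"
  proof
    assume "1 + (B *v v) $ k = 0"
    then have "(B *v v) $ k = - 1" by (simp add: add_eq_0_iff)
    with Bvk[OF small[OF v(1)]] show False by simp
  qed
  ultimately have vk: "v $ k = 1" by simp
  have "X *v v = spike k *v v + B *v v"
    by (simp add: B_def matrix_vector_mult_diff_rdistrib)
  also have "\<dots> = (B *v v) $ k *s v"
    using v(2) by (simp add: spike_mult_vec vk f_def e_def algebra_simps)
  finally show thesis
    using that vk small[OF v(1)] unfolding B_def by blast
qed


lemma real_imag_mult_vec:
  fixes X :: "complex ^ 'n ^ 'm"
  shows "Re ((X *v v) $ i) = (map_matrix Re X *v (\<chi> j. Re (v $ j))) $ i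
      - (map_matrix Im X *v (\<chi> j. Im (v $ j))) $ i"
    and "Im ((X *v v) $ i) = (map_matrix Im X *v (\<chi> j. Re (v $ j))) $ i
      + (map_matrix Re X *v (\<chi> j. Im (v $ j))) $ i"
  by (simp_all add: matrix_vector_mult_def sum_subtractf sum.distrib)

lemma norm_diff_real_imag:
  fixes X :: "complex ^ 'n ^ 'm" and A :: "real ^ 'n ^ 'm"
  shows "(norm (map_matrix complex_of_real A - X))\<^sup>2 =
    (norm (A - map_matrix Re X))\<^sup>2 + (norm (map_matrix Im X))\<^sup>2"
  by (simp add: norm_eq_frobenius sum_nonneg real_sqrt_pow2 cmod_power2 flip: sum.distrib)

text \<open>With \<open>X = M + i N\<close> and an eigenpair \<open>X (a + i b) = (\<alpha> + i \<beta>) (a + i b)\<close>, the real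
  matrix \<open>M\<close> maps \<open>a\<close> to \<open>\<alpha> a\<close> up to the error \<open>N b - \<beta> b\<close>, which is quadratic in \<open>N\<close>.
  So a rank-one correction of \<open>M\<close> is stable, and for small \<open>N\<close> it costs less than the
  squared norm of \<open>N\<close> saved by passing from \<open>X\<close> to \<open>M\<close>.\<close>
lemma real_approximant_near_spike:
  fixes A :: "real ^ 'n ^ 'n"
  assumes A: "norm (A - spike k) \<le> 1 / 60"
    and X: "X \<in> stable_matrices" "norm (complexify A - X) \<le> 1 / 60"
  obtains Y where "complexify Y \<in> stable_matrices" "norm (A - Y) \<le> norm (complexify A - X)"
proof -
  define M where "M = map_matrix Re X"
  define N where "N = map_matrix Im X"
  define B where "B = M - spike k"
  define q where "q = norm N"
  have split: "(norm (complexify A - X))\<^sup>2 = (norm (A - M))\<^sup>2 + q\<^sup>2"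
    unfolding M_def N_def q_def by (rule norm_diff_real_imag)
  have "q \<le> norm (complexify A - X)" "norm (A - M) \<le> norm (complexify A - X)"
    by (rule power2_le_imp_le; simp add: split)+
  then have q: "0 \<le> q" "q \<le> 1 / 60" and AM: "norm (A - M) \<le> 1 / 60"
    using X(2) by (auto simp: q_def)
  have BB: "norm B \<le> 1 / 30"
    using norm_triangle_ineq[of "M - A" "A - spike k"] A AM
    by (simp add: B_def norm_minus_commute[of M A])
  have near: "norm (X - spike k) \<le> 1 / 30"
  proof -
    have "norm (complexify A - spike k) \<le> 1 / 60"
      using A by (metis complexify_diff complexify_spike norm_complexify)
    then show ?thesis
      using X(2) norm_triangle_ineq[of "X - complexify A" "complexify A - spike k"]
      by (simp add: norm_minus_commute[of X "complexify A"])
  qed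
  obtain l v where v: "X *v v = l *s v" "l = ((X - spike k) *v v) $ k" "v $ k = 1" "norm v \<le> 3 / 2"
    using eigenvector_near_spike[OF near] by metis
  define a :: "real ^ 'n" where "a = (\<chi> j. Re (v $ j))"
  define b :: "real ^ 'n" where "b = (\<chi> j. Im (v $ j))"
  define \<alpha> where "\<alpha> = Re l"
  define \<beta> where "\<beta> = Im l"
  have ak: "a $ k = 1" and bk: "b $ k = 0" by (simp_all add: a_def b_def v)
  have "v \<noteq> 0" using v(3) by auto
  then have \<alpha>_le: "\<alpha> \<le> 0"
    using X(1) v(1) by (auto simp: stable_matrices_def eigenvalue_def \<alpha>_def)
  have Ma: "M *v a - N *v b = \<alpha> *s a - \<beta> *s b"
    unfolding vec_eq_iff
    using real_imag_mult_vec(1)[of X v] v(1)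
    by (simp add: M_def N_def a_def b_def \<alpha>_def \<beta>_def)
  have Na: "N *v a + M *v b = \<alpha> *s b + \<beta> *s a"
    unfolding vec_eq_iff
    using real_imag_mult_vec(2)[of X v] v(1)
    by (simp add: M_def N_def a_def b_def \<alpha>_def \<beta>_def)
  have norm_a: "norm a \<le> 3 / 2"
  proof -
    have "norm a \<le> norm v"
      unfolding norm_vec_def by (intro L2_set_mono) (auto simp: a_def abs_Re_le_cmod)
    with v(4) show ?thesis by simp
  qed
  have \<alpha>_small: "\<bar>\<alpha>\<bar> \<le> 1 / 20"
  proof -
    have "norm ((X - spike k) *v v) \<le> 1 / 30 * (3 / 2)"
      using norm_matrix_vector_mult_le[of "X - spike k" v] near v(4)
      by (smt (verit) mult_mono norm_ge_zero)
    then have "norm l \<le> 1 / 20"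
      using Finite_Cartesian_Product.norm_nth_le[of "(X - spike k) *v v" k] unfolding v(2) by simp
    then show ?thesis
      using abs_Re_le_cmod[of l] unfolding \<alpha>_def by simp
  qed
  have Mb: "M *v b = - b + B *v b"
    by (simp add: B_def matrix_vector_mult_diff_rdistrib spike_mult_vec bk)
  have \<beta>_eq: "\<beta> = (N *v a) $ k + (B *v b) $ k"
    using arg_cong[OF Na, of "\<lambda>u. u $ k"] by (simp add: Mb ak bk)
  have norm_Na: "norm (N *v a) \<le> 3 / 2 * q"
    using norm_matrix_vector_mult_le[of N a] norm_a q(1) unfolding q_def
    by (smt (verit) mult.commute mult_right_mono)
  have norm_Bb: "norm (B *v b) \<le> 1 / 30 * norm b"
    using norm_matrix_vector_mult_le[of B b] BB
    by (meson mult_right_mono norm_ge_zero order_trans)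
  have \<beta>_bound: "\<bar>\<beta>\<bar> \<le> 3 / 2 * q + 1 / 30 * norm b"
    unfolding \<beta>_eq using norm_Na norm_Bb
      Finite_Cartesian_Product.norm_nth_le[of "N *v a" k] Finite_Cartesian_Product.norm_nth_le[of "B *v b" k]
    by (simp add: real_norm_def)
  \<comment> \<open>\<open>M\<close> is close to -1 on \<open>b\<close>, whose entry
    \<open>k\<close> is 0, so the imaginary part of the eigenvector equation can be solved for
    \<open>b\<close>. The terms on the right are bounded by multiples of \<open>q\<close> and small
    multiples of \<open>norm b\<close>, and the latter are absorbed.\<close>
  have "b = N *v a + B *v b - \<alpha> *s b - \<beta> *s a"
    using Na by (simp add: Mb algebra_simps)
  then have "norm b \<le> norm (N *v a) + norm (B *v b) + norm (\<alpha> *s b) + norm (\<beta> *s a)"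
    by (smt (verit) norm_triangle_ineq norm_triangle_ineq4)
  also have "\<dots> \<le> 3 / 2 * q + 1 / 30 * norm b + 1 / 20 * norm b + (3 / 2 * q + 1 / 30 * norm b) * (3 / 2)"
    unfolding norm_vector_scalar_mult real_norm_def
    using norm_Na norm_Bb \<alpha>_small \<beta>_bound norm_a q(1) by (intro add_mono mult_mono) auto
  finally have norm_b: "norm b \<le> 5 * q" using q(1) by argo
  then have \<beta>_small: "\<bar>\<beta>\<bar> \<le> 2 * q" using \<beta>_bound q(1) by simp
  define w where "w = N *v b - \<beta> *s b"
  have "norm w \<le> norm N * norm b + \<bar>\<beta>\<bar> * norm b"
    unfolding w_def
    using norm_matrix_vector_mult_le[of N b] norm_triangle_ineq4[of "N *v b" "\<beta> *s b"]
    by (simp add: norm_vector_scalar_mult)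
  also have "\<dots> \<le> q * (5 * q) + 2 * q * (5 * q)"
    using norm_b \<beta>_small q(1) unfolding q_def[symmetric] by (intro add_mono mult_mono) auto
  finally have norm_w: "norm w \<le> 15 * q\<^sup>2" by (simp add: power2_eq_square)
  \<comment> \<open>The matrix with \<open>w\<close> as column \<open>k\<close> and zeros elsewhere:
    it sends \<open>a\<close> to \<open>w\<close> because \<open>a $ k = 1\<close>, and its norm is
    that of \<open>w\<close>.\<close>
  define R where "R = (\<chi> i. axis k (w $ i))"
  define Y where "Y = M - R"
  have norm_R: "norm R = norm w"
    by (simp add: R_def norm_vec_def[of "\<chi> i. axis k (w $ i)"] norm_axis) (simp add: norm_vec_def)
  have Ra: "R *v a = w"
    by (simp add: vec_eq_iff R_def matrix_vector_mult_def axis_def ak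
        if_distrib[where f = "\<lambda>x. x * _"] cong: if_cong)
  have "M *v a = \<alpha> *s a + w"
    using Ma by (simp add: w_def algebra_simps)
  then have Ya: "Y *v a = \<alpha> *s a"
    by (simp add: Y_def matrix_vector_mult_diff_rdistrib Ra)
  have q2: "q\<^sup>2 \<le> (1 / 60)\<^sup>2"
    using q by (intro power_mono)
  have "complexify Y \<in> stable_matrices"
  proof (rule stable_near_spike)
    have "norm (Y - spike k) \<le> norm B + norm R"
      using norm_triangle_ineq4[of B R] by (simp add: Y_def B_def algebra_simps)
    also have "\<dots> \<le> 1 / 16"
      using BB norm_R norm_w q2 by (simp add: power2_eq_square)
    finally show "norm (complexify Y - spike k) \<le> 1 / 16"
      by (metis complexify_diff complexify_spike norm_complexify)
    show "complexify Y *v (\<chi> i. of_real (a $ i)) = of_real \<alpha> *s (\<chi> i. of_real (a $ i))"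
      using Ya by (simp add: vec_eq_iff matrix_vector_mult_def flip: of_real_mult of_real_sum)
    show "norm (\<chi> i. complex_of_real (a $ i)) \<le> 3 / 2"
      using norm_a by (simp add: norm_vec_def)
  qed (use ak \<alpha>_le in auto)
  moreover have "norm (A - Y) \<le> norm (complexify A - X)"
  proof (rule power2_le_imp_le)
    define p where "p = norm (A - M)"
    have p: "0 \<le> p" "p \<le> 1 / 60" using AM by (simp_all add: p_def)
    have "norm (A - Y) \<le> p + 15 * q\<^sup>2"
      using norm_triangle_ineq[of "A - M" R] norm_R norm_w by (simp add: Y_def p_def algebra_simps)
    then have "(norm (A - Y))\<^sup>2 \<le> (p + 15 * q\<^sup>2)\<^sup>2"
      by (intro power_mono) auto
    also have "\<dots> = p\<^sup>2 + (30 * p + 225 * q\<^sup>2) * q\<^sup>2"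
      by (simp add: power2_eq_square algebra_simps)
    \<comment> \<open>The bounds by 1/60 make the factor \<open>30 * p + 225 * q\<^sup>2\<close> at
      most 1/2 + 1/16.\<close>
    also have "\<dots> \<le> p\<^sup>2 + 1 * q\<^sup>2"
      using p q2 by (intro add_mono mult_right_mono) (auto simp: power2_eq_square)
    finally show "(norm (A - Y))\<^sup>2 \<le> (norm (complexify A - X))\<^sup>2"
      by (simp add: split p_def)
  qed simp
  ultimately show thesis by (rule that)
qed

text \<open>The spike is itself stable, so a nearest stable matrix lies within 1/60 of
  \<open>A\<close> and has a real stable replacement that is no farther away.\<close>

lemma d_real_eq_d_complex_near_spike:
  fixes A :: "real ^ 'n ^ 'n"
  assumes "A \<in> ball (spike k) (1 / 60)"
  shows "d_real A = d_complex A"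
proof (rule antisym)
  have A: "norm (A - spike k) \<le> 1 / 60"
    using assms by (simp add: dist_norm norm_minus_commute)
  obtain X where X: "X \<in> stable_matrices" "d_complex A = dist (complexify A) X"
    unfolding d_complex_infdist
    using infdist_attains_inf[OF closed_stable_matrices] zero_stable by blast
  have "dist (complexify A) X \<le> dist (complexify A) (spike k)"
    unfolding X(2)[symmetric] d_complex_infdist by (intro infdist_le spike_stable)
  also have "\<dots> = norm (complexify A - complexify (spike k))"
    by (simp add: dist_norm complexify_spike)
  also have "\<dots> \<le> 1 / 60"
    using A by (simp only: complexify_diff norm_complexify)
  finally obtain Y where "complexify Y \<in> stable_matrices" "norm (A - Y) \<le> norm (complexify A - X)"
    using real_approximant_near_spike[OF A X(1)] by (auto simp: dist_norm)
  moreover from this have "d_real A \<le> dist (complexify A) (complexify Y)"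
    unfolding d_real_infdist by (intro infdist_le) (simp add: complexify_real)
  ultimately show "d_real A \<le> d_complex A"
    by (simp add: X(2) dist_norm complexify_diff norm_complexify)
qed (rule d_complex_le_d_real)

subsection \<open>A matrix whose nearest stable matrices are not real\<close>

text \<open>A zero of \<open>det (mat 1 - u *\<^sub>R Y)\<close> with \<open>u > 0\<close> would
  give the eigenvalue \<open>1 / u\<close>. So this determinant keeps the sign of its value 1 at
  \<open>u = 0\<close>; rescaling gives \<open>det (mat e - Y) > 0\<close> for \<open>e > 0\<close>,
  and \<open>e\<close> tends to 0.\<close>

lemma det_uminus_nonneg_if_stable:
  fixes Y :: "real ^ 'n ^ 'n"
  assumes "complexify Y \<in> stable_matrices"
  shows "det (- Y) \<ge> 0"
proof -
  have nz: "det (mat 1 - u *\<^sub>R Y) \<noteq> 0" if "u \<ge> 0" for u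
  proof
    assume "det (mat 1 - u *\<^sub>R Y) = 0"
    then obtain v where v: "v \<noteq> 0" "(mat 1 - u *\<^sub>R Y) *v v = 0"
      by (auto simp: det_eq_0_iff_kernel)
    then have uv: "u *\<^sub>R (Y *v v) = v"
      by (simp add: matrix_vector_mult_diff_rdistrib scaleR_matrix_vector_assoc)
    with v(1) have "u \<noteq> 0" by auto
    with that have "u > 0" by simp
    have "v $ i = u * (Y *v v) $ i" for i
      using arg_cong[OF uv, of "\<lambda>x. x $ i"] by simp
    then have Yv: "(Y *v v) $ i = v $ i / u" for i
      using \<open>u > 0\<close> by (simp add: field_simps)
    define z :: "complex ^ 'n" where "z = (\<chi> i. of_real (v $ i))"
    have "complexify Y *v z = of_real (1 / u) *s z"
    proof -
      have "(complexify Y *v z) $ i = of_real ((Y *v v) $ i)" for i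
        by (simp add: z_def matrix_vector_mult_def)
      then show ?thesis by (simp add: vec_eq_iff Yv z_def)
    qed
    moreover have "z \<noteq> 0" using v(1) by (auto simp: z_def vec_eq_iff)
    ultimately have "Re (of_real (1 / u)) \<le> 0"
      using assms unfolding stable_matrices_def eigenvalue_def by blast
    with \<open>u > 0\<close> show False by (simp add: field_simps)
  qed
  have pos: "det (mat 1 - u *\<^sub>R Y) > 0" if "u \<ge> 0" for u
  proof (rule ccontr)
    assume "\<not> ?thesis"
    moreover have "det (mat 1 - 0 *\<^sub>R Y) = 1" by simp
    moreover have "continuous_on {0..u} (\<lambda>u. det (mat 1 - u *\<^sub>R Y))"
      by (intro continuous_on_det) (auto intro!: continuous_intros)
    ultimately have "\<exists>s\<ge>0. s \<le> u \<and> det (mat 1 - s *\<^sub>R Y) = 0"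
      using that by (intro IVT2') auto
    with nz show False by blast
  qed
  have det_pos: "det (mat e - Y) > 0" if "e > 0" for e
  proof -
    have "(mat e ** M) $ i $ j = e * M $ i $ j" for M :: "real ^ 'n ^ 'n" and i j
      by (simp add: matrix_matrix_mult_def mat_def if_distrib[where f = "\<lambda>a. a * _"] cong: if_cong)
    then have "mat e - Y = mat e ** (mat 1 - inverse e *\<^sub>R Y)"
      using that by (simp add: vec_eq_iff mat_def field_simps)
    moreover have "det (mat e :: real ^ 'n ^ 'n) = e ^ CARD('n)"
      by (subst det_diagonal) (auto simp: mat_def)
    ultimately have "det (mat e - Y) = e ^ CARD('n) * det (mat 1 - inverse e *\<^sub>R Y)"
      by (simp only: det_mul)
    with that pos[of "inverse e"] show ?thesis by simp
  qed
  have "isCont (\<lambda>e. det (mat e - Y)) 0"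
  proof -
    have "continuous_on UNIV (\<lambda>e. (mat e - Y) $ i $ j)" for i j
      by (cases "i = j") (auto simp: mat_def intro!: continuous_intros)
    then have "continuous_on UNIV (\<lambda>e. det (mat e - Y))"
      by (rule continuous_on_det)
    then show ?thesis by (simp add: continuous_on_eq_continuous_at)
  qed
  then have "((\<lambda>e. det (mat e - Y)) \<longlongrightarrow> det (mat 0 - Y)) (at_right 0)"
    by (simp add: isCont_def filterlim_at_split)
  then have "det (mat 0 - Y) \<ge> 0"
    by (rule tendsto_lowerbound)
      (auto simp: eventually_at_right_less det_pos less_imp_le
        intro: eventually_mono[OF eventually_at_right_less])
  then show ?thesis by simp
qed

text \<open>The segment from \<open>A\<close> to a real stable matrix must cross the singular matrices, whose
  distance from \<open>A\<close> is at least the least singular value of \<open>A\<close>.\<close>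
lemma one_le_d_real:
  fixes A :: "real ^ 'n ^ 'n"
  assumes expand: "\<And>v. norm v \<le> norm (A *v v)" and neg: "det (- A) < 0"
  shows "1 \<le> d_real A"
proof -
  have "1 \<le> norm (A - Y)" if Y: "complexify Y \<in> stable_matrices" for Y
  proof (rule ccontr)
    assume less: "\<not> 1 \<le> norm (A - Y)"
    \<comment> \<open>The path runs from \<open>- A\<close> at \<open>t = 0\<close> to
      \<open>- Y\<close> at \<open>t = 1\<close>, so its determinant goes from negative to
      nonnegative.\<close>
    have "continuous_on {0..1} (\<lambda>t. det (- A + t *\<^sub>R (A - Y)))"
      by (intro continuous_on_det) (auto intro!: continuous_intros)
    then obtain t where t: "0 \<le> t" "t \<le> 1" "det (- A + t *\<^sub>R (A - Y)) = 0"
      using IVT'[of "\<lambda>t. det (- A + t *\<^sub>R (A - Y))" 0 0 1] neg det_uminus_nonneg_if_stable[OF Y]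
      by auto
    then obtain v where v: "v \<noteq> 0" "(- A + t *\<^sub>R (A - Y)) *v v = 0"
      by (auto simp: det_eq_0_iff_kernel)
    then have "A *v v = t *\<^sub>R ((A - Y) *v v)"
      by (simp add: matrix_vector_mult_diff_rdistrib[of "t *\<^sub>R (A - Y)" A] scaleR_matrix_vector_assoc)
    then have "norm (A *v v) = t * norm ((A - Y) *v v)"
      using t(1) by simp
    also have "\<dots> \<le> 1 * (norm (A - Y) * norm v)"
      using t norm_matrix_vector_mult_le[of "A - Y" v] by (intro mult_mono) auto
    also have "\<dots> < norm v" using less v(1) by simp
    finally show False using expand[of v] by simp
  qed
  then have "1 \<le> dist (complexify A) X" if "X \<in> stable_matrices \<inter> real_matrices" for X
    using that real_matricesE[of X]
    by (metis Int_iff complexify_diff dist_norm norm_complexify)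
  then show ?thesis
    unfolding d_real_infdist using zero_stable_real
    by (auto simp: infdist_def intro!: cINF_greatest)
qed

section \<open>A complex stable matrix closer than every real one\<close>

lemma sum_three:
  fixes f :: "'n::finite \<Rightarrow> 'a::comm_monoid_add"
  assumes "distinct [i0, i1, i2]" "\<And>j. j \<notin> {i0, i1, i2} \<Longrightarrow> f j = 0"
  shows "sum f UNIV = f i0 + f i1 + f i2"
proof -
  have "sum f UNIV = sum f {i0, i1, i2}"
    using assms(2) by (intro sum.mono_neutral_right) auto
  then show ?thesis using assms(1) by (simp add: add.assoc)
qed

text \<open>The hypotheses make \<open>w\<close> a primitive cube root of unity, and the right-hand
  side is the norm form of the Eisenstein integers. It evaluates the entries of \<open>Z\<close>
  below.\<close>

lemma norm_eisenstein:
  assumes "w\<^sup>2 + w + 1 = 0" "Re w = - 1 / 2"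
  shows "(norm (of_real a + of_real b * w))\<^sup>2 = a\<^sup>2 - a * b + b\<^sup>2"
proof -
  have "Re (w\<^sup>2 + w + 1) = 0" using assms(1) by simp
  then have "(Im w)\<^sup>2 = 3 / 4"
    using assms(2) by (simp add: power2_eq_square)
  then show ?thesis
    using assms(2) by (simp add: cmod_power2 power_mult_distrib) (simp add: power2_eq_square field_simps)
qed

text \<open>\<open>A\<close> is the direct sum of the permutation matrix \<open>P\<close> of a 3-cycle and of minus the identity.
  With unit eigenvectors
  \<open>f\<^sub>0\<close>, \<open>f\<^sub>1\<close> of \<open>P\<close> for the eigenvalues \<open>1\<close> and \<open>w\<close> (a primitive cube root of unity), in the basis
  \<open>(f\<^sub>0 + f\<^sub>1, f\<^sub>0 - f\<^sub>1)\<close> the matrix \<open>P\<close> has constant diagonal of real part \<open>1/4\<close>. The matrix \<open>Z\<close>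
  removes this real part and the entry below the diagonal, and has squared norm \<open>7/8\<close>.\<close>
lemma ex_d_complex_less_d_real:
  assumes "CARD('n::finite) \<ge> 3"
  obtains A :: "real ^ 'n ^ 'n" where "d_complex A < d_real A"
proof -
  obtain T :: "'n set" where "card T = 3"
    using obtain_subset_with_card_n[OF assms] by metis
  then obtain i0 i1 i2 where "T = {i0, i1, i2}" "i0 \<noteq> i1" "i1 \<noteq> i2" "i0 \<noteq> i2"
    by (auto simp: card_3_iff)
  then have dist: "distinct [i0, i1, i2]" and
    neq: "i0 \<noteq> i1" "i1 \<noteq> i0" "i1 \<noteq> i2" "i2 \<noteq> i1" "i0 \<noteq> i2" "i2 \<noteq> i0"
    by auto
  \<comment> \<open>A 3-cycle on the chosen indices, written with two transpositions so that its
    sign is immediate.\<close>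
  define p where "p = Transposition.transpose i1 i2 \<circ> Transposition.transpose i0 i1"
  have p_simps: "p i0 = i2" "p i1 = i0" "p i2 = i1" "j \<notin> {i0, i1, i2} \<Longrightarrow> p j = j" for j
    using neq by (auto simp: p_def Transposition.transpose_def)
  have perm: "p permutes UNIV"
    unfolding p_def by (intro permutes_compose permutes_swap_id) auto
  have p_T: "p i \<in> {i0, i1, i2} \<longleftrightarrow> i \<in> {i0, i1, i2}" for i
    using p_simps by (cases "i \<in> {i0, i1, i2}") auto
  define s :: "'n \<Rightarrow> real" where "s i = (if i \<in> {i0, i1, i2} then 1 else - 1)" for i
  define A :: "real ^ 'n ^ 'n" where "A = (\<chi> i j. if j = p i then s i else 0)"
  have Av: "(A *v v) $ i = s i * v $ p i" for v i
    by (simp add: A_def matrix_vector_mult_def if_distrib[where f = "\<lambda>a. a * _"] cong: if_cong)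
  have "norm (A *v v) = norm v" for v
  proof -
    have "(\<Sum>i\<in>UNIV. (s i * v $ p i)\<^sup>2) = (\<Sum>i\<in>UNIV. (v $ p i)\<^sup>2)"
      by (intro sum.cong) (auto simp: s_def)
    also have "\<dots> = (\<Sum>i\<in>UNIV. (v $ i)\<^sup>2)"
      using sum.permute[OF perm, of "\<lambda>i. (v $ i)\<^sup>2"] by (simp add: o_def)
    finally show ?thesis by (simp add: norm_vec_def L2_set_def Av)
  qed
  moreover have "det (- A) = - 1"
  proof -
    \<comment> \<open>Since \<open>s\<close> is invariant under \<open>p\<close>, \<open>- A\<close>
      is \<open>D\<close> with its rows permuted. The permutation is even, and exactly three
      diagonal entries of \<open>D\<close> are -1.\<close>
    define D :: "real ^ 'n ^ 'n" where "D = (\<chi> i j. if i = j then - s i else 0)"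
    have "- A = (\<chi> i. D $ p i)"
      using p_T by (auto simp: A_def D_def vec_eq_iff s_def)
    moreover have "sign p = 1"
      unfolding p_def using neq by (simp add: sign_compose permutation_swap_id sign_swap_id)
    moreover have "det D = (\<Prod>i\<in>UNIV. - s i)"
      by (subst det_diagonal) (auto simp: D_def)
    moreover have "(\<Prod>i\<in>UNIV. - s i) = (\<Prod>i\<in>{i0, i1, i2}. - s i)"
      by (intro prod.mono_neutral_right) (auto simp: s_def)
    ultimately show ?thesis
      using neq by (simp add: det_permute_rows[OF perm] s_def)
  qed
  ultimately have "1 \<le> d_real A"
    by (intro one_le_d_real) simp_all
  moreover have "d_complex A < 1"
  proof -
    define w where "w = Complex (- 1 / 2) (sqrt 3 / 2)"
    have w: "w\<^sup>2 + w + 1 = 0" and Re_w: "Re w = - 1 / 2"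
      by (simp_all add: w_def complex_eq_iff power2_eq_square)
    \<comment> \<open>Every entry is an Eisenstein integer over 12; the three nonzero rows
      contribute 6/144, 69/144 and 51/144 to the squared norm.\<close>
    define Z :: "complex ^ 'n ^ 'n" where "Z = (\<chi> i j.
      (if i = i0 then (if j = i0 then 2 else if j = i1 then 1 + w else if j = i2 then - w else 0)
       else if i = i1 then
         (if j = i0 then 6 - w else if j = i1 then 5 + 3 * w else if j = i2 then 1 - 2 * w else 0)
       else if i = i2 then
         (if j = i0 then 1 - 5 * w else if j = i1 then 3 - w else if j = i2 then - 1 - 3 * w else 0)
       else 0) / 12)"
    have "(norm Z)\<^sup>2 = 7 / 8"
    proof -
      have "(norm Z)\<^sup>2 = (\<Sum>i\<in>UNIV. \<Sum>j\<in>UNIV. (norm (Z $ i $ j))\<^sup>2)"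
        by (simp add: norm_eq_frobenius sum_nonneg)
      also have "\<dots> = (\<Sum>j\<in>UNIV. (norm (Z $ i0 $ j))\<^sup>2) + (\<Sum>j\<in>UNIV. (norm (Z $ i1 $ j))\<^sup>2)
          + (\<Sum>j\<in>UNIV. (norm (Z $ i2 $ j))\<^sup>2)"
        by (rule sum_three[OF dist]) (simp add: Z_def)
      also have "(\<Sum>j\<in>UNIV. (norm (Z $ i0 $ j))\<^sup>2) = 6 / 144"
        using norm_eisenstein[OF w Re_w, of 2 0] norm_eisenstein[OF w Re_w, of 1 1]
          norm_eisenstein[OF w Re_w, of 0 "-1"]
        by (subst sum_three[OF dist]) (use neq in \<open>simp_all add: Z_def norm_divide power_divide\<close>)
      also have "(\<Sum>j\<in>UNIV. (norm (Z $ i1 $ j))\<^sup>2) = 69 / 144"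
        using norm_eisenstein[OF w Re_w, of 6 "-1"] norm_eisenstein[OF w Re_w, of 5 3]
          norm_eisenstein[OF w Re_w, of 1 "-2"]
        by (subst sum_three[OF dist]) (use neq in \<open>simp_all add: Z_def norm_divide power_divide\<close>)
      also have "(\<Sum>j\<in>UNIV. (norm (Z $ i2 $ j))\<^sup>2) = 51 / 144"
        using norm_eisenstein[OF w Re_w, of 1 "-5"] norm_eisenstein[OF w Re_w, of 3 "-1"]
          norm_eisenstein[OF w Re_w, of "-1" "-3"]
        by (subst sum_three[OF dist]) (use neq in \<open>simp_all add: Z_def norm_divide power_divide\<close>)
      finally show ?thesis by simp
    qed
    then have "norm Z < 1"
      by (simp add: power2_less_imp_less)
    moreover have "complexify A - Z \<in> stable_matrices"
    proof -
      have "Re \<mu> \<le> 0" if ev: "eigenvalue (complexify A - Z) \<mu>" for \<mu>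
      proof (rule ccontr)
        assume \<mu>: "\<not> Re \<mu> \<le> 0"
        obtain v where v: "v \<noteq> 0" "(complexify A - Z) *v v = \<mu> *s v"
          using ev by (auto simp: eigenvalue_def)
        have cA: "(complexify A *v v) $ i = of_real (s i) * v $ p i" for i
          by (simp add: A_def matrix_vector_mult_def if_distrib[where f = "\<lambda>a. a * _"]
              if_distrib[where f = of_real] cong: if_cong)
        have eq: "of_real (s i) * v $ p i - (Z *v v) $ i = \<mu> * v $ i" for i
          using arg_cong[OF v(2), of "\<lambda>u. u $ i"]
          by (simp add: matrix_vector_mult_diff_rdistrib cA)
        have outside: "v $ i = 0" if i: "i \<notin> {i0, i1, i2}" for i
        proof -
          have "(Z *v v) $ i = 0" using i by (simp add: Z_def matrix_vector_mult_def)
          then have "\<mu> * v $ i = - v $ i"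
            using eq[of i] i p_simps(4)[OF i] by (auto simp: s_def)
          then have "(1 + \<mu>) * v $ i = 0" by (simp add: distrib_right)
          moreover have "1 + \<mu> \<noteq> 0" using \<mu> by (auto simp: complex_eq_iff)
          ultimately show ?thesis by simp
        qed
        have Zv: "(Z *v v) $ i = Z $ i $ i0 * v $ i0 + Z $ i $ i1 * v $ i1 + Z $ i $ i2 * v $ i2" for i
          unfolding matrix_vector_mult_def
          by (simp, rule sum_three[OF dist]) (simp add: outside)
        define a b c where "a = v $ i0" and "b = v $ i1" and "c = v $ i2"
        have eq12: "12 * (of_real (s i) * v $ p i) - 12 * (Z *v v) $ i = 12 * \<mu> * v $ i" for i
          using arg_cong[OF eq[of i], of "\<lambda>x. 12 * x"] by (simp only: right_diff_distrib mult.assoc)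
        have "12 * (Z *v v) $ i0 = 2 * a + (1 + w) * b - w * c"
          unfolding Zv using neq by (simp add: Z_def a_def b_def c_def field_simps)
        then have e0: "12 * c - (2 * a + (1 + w) * b - w * c) = 12 * \<mu> * a"
          using eq12[of i0] by (simp add: p_simps s_def a_def c_def)
        have "12 * (Z *v v) $ i1 = (6 - w) * a + (5 + 3 * w) * b + (1 - 2 * w) * c"
          unfolding Zv using neq by (simp add: Z_def a_def b_def c_def field_simps)
        then have e1: "12 * a - ((6 - w) * a + (5 + 3 * w) * b + (1 - 2 * w) * c) = 12 * \<mu> * b"
          using eq12[of i1] by (simp add: p_simps s_def a_def b_def c_def)
        have "12 * (Z *v v) $ i2 = (1 - 5 * w) * a + (3 - w) * b + (- 1 - 3 * w) * c"
          unfolding Zv using neq by (simp add: Z_def a_def b_def c_def field_simps)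
        then have e2: "12 * b - ((1 - 5 * w) * a + (3 - w) * b + (- 1 - 3 * w) * c) = 12 * \<mu> * c"
          using eq12[of i2] by (simp add: p_simps s_def a_def b_def c_def)
        \<comment> \<open>\<open>(0, 1, 1 + w)\<close> is a left eigenvector of the 3 by 3 block,
          with the purely imaginary eigenvalue \<open>(1 + 2 * w) / 4\<close>; it is paired with
          \<open>v\<close>.\<close>
        have "(4 * \<mu> - (1 + 2 * w)) * (b + (1 + w) * c) = 0"
          using e1 e2 w by algebra
        moreover have "Re (4 * \<mu> - (1 + 2 * w)) \<noteq> 0" using \<mu> Re_w by simp
        then have \<mu>0: "4 * \<mu> - (1 + 2 * w) \<noteq> 0" by force
        ultimately have "b + (1 + w) * c = 0" by simp
        then have bc: "b = - (1 + w) * c" by algebra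
        \<comment> \<open>Likewise \<open>(1, w\<^sup>2, w)\<close> is a left eigenvector, for the
          eigenvalue \<open>w\<^sup>2\<close> of the permutation matrix, which has real part
          -1/2.\<close>
        have "(\<mu> - w\<^sup>2) * (a + w\<^sup>2 * b + w * c) = 0"
          using e0 e1 e2 w by algebra
        moreover have "Re (\<mu> - w\<^sup>2) \<noteq> 0"
        proof -
          have "w\<^sup>2 = - 1 - w" using w by (simp add: eq_neg_iff_add_eq_0 algebra_simps)
          then show ?thesis using \<mu> Re_w by simp
        qed
        then have "\<mu> - w\<^sup>2 \<noteq> 0" by force
        ultimately have ac: "a = - 2 * w * c"
          using bc w by simp algebra
        \<comment> \<open>Only multiples of \<open>(- 2 * w, - (1 + w), 1)\<close> remain, and on
          these the third row again gives the eigenvalue \<open>(1 + 2 * w) / 4\<close>.\<close>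
        have "(4 * \<mu> - (1 + 2 * w)) * c = 0"
          using e2 bc ac w by algebra
        then have "c = 0" using \<mu>0 by simp
        then have "v $ i = 0" for i
          using bc ac outside[of i] by (cases "i \<in> {i0, i1, i2}") (auto simp: a_def b_def c_def)
        then show False using v(1) by (simp add: vec_eq_iff)
      qed
      then show ?thesis by (auto simp: stable_matrices_def)
    qed
    then have "d_complex A \<le> dist (complexify A) (complexify A - Z)"
      unfolding d_complex_infdist by (rule infdist_le)
    ultimately show ?thesis by (simp add: dist_norm)
  qed
  ultimately show thesis
    using that[of A] by simp
qed

subsection \<open>Probabilities on the sphere\<close>

text \<open>A shrunken copy of \<open>U\<close> meets the unit ball in a nonempty open set, which
  has positive Lebesgue measure and is sent into \<open>S\<close> by radial projection.\<close>

lemma measure_uniform_sphere_pos: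
  fixes U S :: "'a::euclidean_space set"
  assumes "open U" "U \<noteq> {}" "S \<in> sets borel"
    and ray: "\<And>x c. x \<in> U \<Longrightarrow> c > 0 \<Longrightarrow> c *\<^sub>R x \<in> S"
  shows "measure uniform_sphere S > 0"
proof -
  interpret prob_space "uniform_sphere :: 'a measure"
    by (rule prob_space_uniform_sphere)
  obtain x where x: "x \<in> U" using assms(2) by blast
  define t where "t = inverse (1 + norm x)"
  have t: "t > 0" by (simp add: t_def add_pos_nonneg)
  define V where "V = ball 0 1 \<inter> (*\<^sub>R) t ` U"
  have "open V" using t assms(1) by (auto simp: V_def intro!: open_Int open_scaling)
  moreover have "t *\<^sub>R x \<in> V"
  proof -
    have "t *\<^sub>R x \<in> ball 0 1"
      by (simp add: t_def field_simps add_pos_nonneg)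
    then show ?thesis
      unfolding V_def by (intro IntI imageI x)
  qed
  ultimately have V: "emeasure lborel V \<noteq> 0" "V \<in> sets lborel"
    using open_not_negligible[of V] by (auto simp: negligible_iff_null_sets null_sets_def)
  have "sgn y \<in> S" if yV: "y \<in> V" for y
  proof -
    obtain u where u: "u \<in> U" "y = t *\<^sub>R u" using yV by (auto simp: V_def)
    have "sgn y = sgn u" using t by (simp add: u sgn_scaleR)
    \<comment> \<open>For \<open>u = 0\<close> also \<open>sgn u = 0\<close>, and \<open>ray\<close>
      with factor 1 applies; otherwise the factor is \<open>inverse (norm u)\<close>.\<close>
    also have "\<dots> \<in> S"
      using ray[OF u(1), of "inverse (norm u)"] ray[OF u(1), of 1]
      by (cases "u = 0") (auto simp: sgn_div_norm divide_inverse_commute)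
    finally show ?thesis .
  qed
  then have "V \<subseteq> ball 0 1 \<inter> sgn -` S" using V_def by blast
  moreover have meas: "sgn -` S \<in> sets borel"
    using measurable_sets[OF sgn_borel_measurable assms(3)] by simp
  ultimately have "emeasure lborel V \<le> emeasure lborel (ball 0 1 \<inter> sgn -` S)"
    by (intro emeasure_mono) auto
  then have "emeasure lborel (ball 0 1 \<inter> sgn -` S) \<noteq> 0" using V(1) by auto
  moreover have "emeasure lborel (ball (0::'a) 1) \<noteq> \<infinity>"
    using emeasure_bounded_finite[of "ball (0::'a) 1"] by auto
  moreover have "emeasure uniform_sphere S
      = emeasure lborel (ball 0 1 \<inter> sgn -` S) / emeasure lborel (ball (0::'a) 1)"
    unfolding uniform_sphere_def using assms(3) meas
    by (subst emeasure_distr) (auto simp: space_uniform_measure)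
  ultimately have "emeasure uniform_sphere S \<noteq> 0"
    by (simp add: ennreal_divide_eq_0_iff)
  then show ?thesis
    by (simp add: emeasure_eq_measure zero_less_measure_iff)
qed

theorem mainTheorem7:
  assumes "CARD('n::finite) \<ge> 3"
  shows "0 < \<P>(A in (uniform_sphere :: (real ^ 'n ^ 'n) measure).
              d_real A = d_complex A \<bar> complexify A \<notin> stable_matrices) \<and>
         \<P>(A in (uniform_sphere :: (real ^ 'n ^ 'n) measure).
              d_real A = d_complex A \<bar> complexify A \<notin> stable_matrices) < 1"
proof -
  interpret prob_space "uniform_sphere :: (real ^ 'n ^ 'n) measure"
    by (rule prob_space_uniform_sphere)
  have sets_eq [simp]: "sets (uniform_sphere :: (real ^ 'n ^ 'n) measure) = sets borel"
    and space_eq [simp]: "space (uniform_sphere :: (real ^ 'n ^ 'n) measure) = UNIV"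
    by (simp_all add: uniform_sphere_def)
  define Q where "Q = {A :: real ^ 'n ^ 'n. complexify A \<notin> stable_matrices}"
  define E where "E = {A :: real ^ 'n ^ 'n. d_real A = d_complex A}"
  have openQ: "open Q"
  proof -
    have "closed (complexify -` (stable_matrices :: (complex ^ 'n ^ 'n) set))"
      by (intro closed_vimage closed_stable_matrices continuous_intros)
    then show ?thesis by (simp add: Q_def closed_def vimage_def Collect_neg_eq)
  qed
  have closedE: "closed E"
    unfolding E_def by (intro closed_Collect_eq continuous_intros)
  have QE [measurable]: "Q \<in> sets borel" "E \<in> sets borel"
    using openQ closedE by auto
  have scaleQ: "c *\<^sub>R A \<in> Q \<longleftrightarrow> A \<in> Q" if "c > 0" for c A
    using that by (simp add: Q_def complexify_scaleR stable_matrices_scaleR_iff)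
  have scaleE: "c *\<^sub>R A \<in> E \<longleftrightarrow> A \<in> E" if "c > 0" for c A
    using that by (simp add: E_def d_real_scaleR d_complex_scaleR)
  have pos: "measure uniform_sphere (E \<inter> Q) > 0"
  proof (rule measure_uniform_sphere_pos)
    fix k :: 'n
    \<comment> \<open>Raising the zero entry of the spike to 1/120 creates a positive eigenvalue but
      stays within 1/60.\<close>
    define A :: "real ^ 'n ^ 'n" where "A = spike k + axis k (axis k (1 / 120))"
    show "open (ball (spike k) (1 / 60) \<inter> Q)" using openQ by auto
    have "complexify A *v axis k 1 = (1 / 120) *s axis k 1"
      by (auto simp: A_def spike_def vec_eq_iff matrix_vector_mult_def axis_def if_distrib[where f = "\<lambda>a. _ * a"]
          if_distrib[where f = complex_of_real] cong: if_cong)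
    moreover have "axis k (1::complex) \<noteq> 0" by (simp add: axis_eq_0_iff)
    ultimately have "eigenvalue (complexify A) (1 / 120)"
      unfolding eigenvalue_def by blast
    then have "A \<in> Q" by (force simp: Q_def stable_matrices_def)
    moreover have "A \<in> ball (spike k) (1 / 60)"
      by (simp add: A_def dist_norm norm_axis)
    ultimately show "ball (spike k) (1 / 60) \<inter> Q \<noteq> {}" by blast
    show "c *\<^sub>R x \<in> E \<inter> Q" if "x \<in> ball (spike k) (1 / 60) \<inter> Q" "c > 0" for x c
      using that d_real_eq_d_complex_near_spike[of x k] by (simp add: scaleQ scaleE) (simp add: E_def)
  qed (use QE in auto)
  have neg: "measure uniform_sphere (Q - E) > 0"
  proof (rule measure_uniform_sphere_pos)
    show "open (- E)" using closedE by (rule open_Compl)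
    obtain A :: "real ^ 'n ^ 'n" where "d_complex A < d_real A"
      using ex_d_complex_less_d_real[OF assms] .
    then have "A \<in> - E" by (simp add: E_def)
    then show "- E \<noteq> {}" by blast
    \<comment> \<open>Stable matrices have both distances 0, so a point outside \<open>E\<close> is
      automatically unstable.\<close>
    show "c *\<^sub>R x \<in> Q - E" if "x \<in> - E" "c > 0" for x c
      using that d_eq_0_if_stable[of x] by (simp add: scaleQ scaleE) (auto simp: E_def Q_def)
  qed (use QE in auto)
  \<comment> \<open>Both summands are positive, so \<open>prob Q > 0\<close>, the conditional
    probability is a genuine quotient, and it lies strictly between 0 and 1.\<close>
  have "prob Q = prob (E \<inter> Q) + prob (Q - E)"
    using QE by (subst finite_measure_Union[symmetric]) (auto intro!: arg_cong[where f = prob])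
  moreover have "cond_prob uniform_sphere (\<lambda>A :: real ^ 'n ^ 'n. d_real A = d_complex A)
      (\<lambda>A. complexify A \<notin> stable_matrices) = prob (E \<inter> Q) / prob Q"
    by (simp add: cond_prob_def E_def Q_def Collect_conj_eq)
  ultimately show ?thesis using pos neg by simp
qed

end
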